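(* Let $p(x),q(x)$ be polynomials with real coefficients and fix a real number $x$ with $p(x)\neq 0$, $q(x)\neq 0$ and $p(x)^2+4q(x)>0$; write $p=p(x)$, $q=q(x)$, and $$\alpha=\frac{p+\sqrt{p^2+4q}}{2},\qquad \beta=\frac{p-\sqrt{p^2+4q}}{2}.$$ Let $a,r$ be nonzero real numbers with $r^n\neq\alpha^n$ and $r^n\neq\beta^n$, let $n\ge 1$, and set $f_k=\dfrac{F_{p,q,k}(x)}{ar^k}$ for $k\ge 0$. Let $\mathcal{F}_n$ be the $n\times n$ right circulant matrix whose $(i,j)$ entry ($0\le i,j\le n-1$) is $f_{(j-i)\bmod n}$. Then $$\det(\mathcal{F}_n)=\frac{(-1)^n r^n F_{p,q,n}(x)^n-\left(qF_{p,q,n-1}(x)-r^n\right)^n}{a^n r^{n(n-1)}\left(r^{2n}-r^nL_{p,q,n}(x)+(-q)^n\right)}.$$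
   Context: The generalized Fibonacci polynomials are defined by $F_{p,q,0}(x)=0$, $F_{p,q,1}(x)=1$, $F_{p,q,n+1}(x)=p(x)F_{p,q,n}(x)+q(x)F_{p,q,n-1}(x)$ for $n\ge1$; the generalized Lucas polynomials by $L_{p,q,0}(x)=2$, $L_{p,q,1}(x)=p(x)$, $L_{p,q,n+1}(x)=p(x)L_{p,q,n}(x)+q(x)L_{p,q,n-1}(x)$ for $n\ge1$. *)

theory Defs
  imports Complex_Main "HOL-Computational_Algebra.Polynomial" "Jordan_Normal_Form.Determinant"
begin

fun gen_fib_poly :: "real poly \<Rightarrow> real poly \<Rightarrow> nat \<Rightarrow> real poly" where
  "gen_fib_poly p q 0 = 0"
| "gen_fib_poly p q (Suc 0) = 1"
| "gen_fib_poly p q (Suc (Suc n)) = p * gen_fib_poly p q (Suc n) + q * gen_fib_poly p q n"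

fun gen_lucas_poly :: "real poly \<Rightarrow> real poly \<Rightarrow> nat \<Rightarrow> real poly" where
  "gen_lucas_poly p q 0 = 2"
| "gen_lucas_poly p q (Suc 0) = p"
| "gen_lucas_poly p q (Suc (Suc n)) = p * gen_lucas_poly p q (Suc n) + q * gen_lucas_poly p q n"

(* The residue of j - i is taken in int, since subtraction on nat truncates. *)
definition right_circulant :: "nat \<Rightarrow> (nat \<Rightarrow> 'a) \<Rightarrow> 'a mat" where
  "right_circulant n c = mat n n (\<lambda>(i, j). c (nat ((int j - int i) mod int n)))"

end

theory Submission
  imports Defs
begin

text \<open>
  Put \<open>A = \<alpha> / r\<close> and \<open>B = \<beta> / r\<close>, and let \<open>S\<close> be the cyclic shift. Right multiplication of the
  circulant matrix by \<open>(I - A S) (I - B S)\<close> applies the Fibonacci recurrence to its entries, so all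
  of them cancel except the two affected by the wrap-around, and the product has the form
  \<open>c I + d S\<close>. All three of these factors are bidiagonal circulants, and
  \<open>det (c I + d S) = c\<^sup>n - (-d)\<^sup>n\<close> by Laplace expansion; no roots of unity are needed.
\<close>

lemma circulant_index:
  assumes "i < n" "j < n"
  shows "nat ((int j - int i) mod int n) = (if i \<le> j then j - i else n + j - i)"
proof (cases "i \<le> j")
  case True
  then show ?thesis
    using assms by (simp add: nat_diff_distrib)
next
  case False
  have "(int j - int i) mod int n = (int j - int i + int n) mod int n"
    by simp
  also have "\<dots> = int j - int i + int n"
    using False assms by (intro mod_pos_pos_trivial) auto
  finally show ?thesis
    using False assms by simp
qed

lemma right_circulant_carrier [simp]: "right_circulant n c \<in> carrier_mat n n"
  by (simp add: right_circulant_def)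

lemma right_circulant_entry:
  assumes "i < n" "j < n"
  shows "right_circulant n c $$ (i, j) = c (if i \<le> j then j - i else n + j - i)"
  using assms by (simp add: right_circulant_def circulant_index)

lemma right_circulant_cong:
  assumes "\<And>k. k < n \<Longrightarrow> f k = g k"
  shows "right_circulant n f = right_circulant n g"
proof (rule eq_matI)
  fix i j
  assume "i < dim_row (right_circulant n g)" "j < dim_col (right_circulant n g)"
  then have "i < n" "j < n"
    by (simp_all add: right_circulant_def)
  then show "right_circulant n f $$ (i, j) = right_circulant n g $$ (i, j)"
    using assms by (simp add: right_circulant_entry)
qed (simp_all add: right_circulant_def)

text \<open>This is \<open>c I + d S\<close>, provided \<open>n \<ge> 2\<close>; for
  \<open>n = 1\<close> offset 1 never occurs and \<open>d\<close> is lost, so the lemmas below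
  assume \<open>n \<ge> 2\<close>.\<close>

definition bidiag_circulant :: "nat \<Rightarrow> 'a \<Rightarrow> 'a \<Rightarrow> 'a :: zero mat" where
  "bidiag_circulant n c d = right_circulant n (\<lambda>k. if k = 0 then c else if k = 1 then d else 0)"

lemma bidiag_circulant_carrier [simp]: "bidiag_circulant n c d \<in> carrier_mat n n"
  by (simp add: bidiag_circulant_def)

lemma bidiag_circulant_entry:
  assumes "i < n" "j < n" "n \<ge> 2"
  shows "bidiag_circulant n c d $$ (i, j) =
    (if i = j then c else if j = Suc i \<or> (j = 0 \<and> Suc i = n) then d else 0)"
  using assms unfolding bidiag_circulant_def by (subst right_circulant_entry) auto

text \<open>Column 0 contains only \<open>c\<close> in row 0 and \<open>d\<close> in the last row.
  Deleting row 0 leaves an upper triangular minor with diagonal \<open>c\<close>; deleting the last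
  row leaves a lower triangular one with diagonal \<open>d\<close>.\<close>

lemma det_bidiag_circulant:
  fixes c d :: "'a :: comm_ring_1"
  assumes n: "n \<ge> 2"
  shows "det (bidiag_circulant n c d) = c ^ n - (- d) ^ n"
proof -
  obtain m where m: "n = Suc m" "m \<ge> 1" "Suc m \<ge> 2"
    using n by (cases n) auto
  let ?M = "bidiag_circulant n c d"
  have dims: "dim_row ?M = n" "dim_col ?M = n"
    by (simp_all add: carrier_matD[OF bidiag_circulant_carrier])
  have del0: "mat_delete ?M 0 0 = mat m m (\<lambda>(i, j). if i = j then c else if j = Suc i then d else 0)"
    by (rule eq_matI) (auto simp: mat_delete_def m dims[unfolded m(1)] bidiag_circulant_entry)
  have delm: "mat_delete ?M m 0 = mat m m (\<lambda>(i, j). if i = j then d else if i = Suc j then c else 0)"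
    by (rule eq_matI) (auto simp: mat_delete_def m dims[unfolded m(1)] bidiag_circulant_entry)
  have det0: "det (mat_delete ?M 0 0) = c ^ m"
    unfolding del0
    by (subst det_upper_triangular[of _ m])
      (auto simp: prod_list_diag_prod upper_triangular_def)
  have detm: "det (mat_delete ?M m 0) = d ^ m"
    unfolding delm
    by (subst det_lower_triangular[of m]) (auto simp: prod_list_diag_prod)
  have "det ?M = (\<Sum>i<n. ?M $$ (i, 0) * cofactor ?M i 0)"
    using n by (intro laplace_expansion_column) auto
  also have "\<dots> = (\<Sum>i\<in>{0, m}. ?M $$ (i, 0) * cofactor ?M i 0)"
    using n by (intro sum.mono_neutral_right) (auto simp: m(1) bidiag_circulant_entry)
  also have "\<dots> = c * c ^ m + d * ((- 1) ^ m * d ^ m)"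
  proof -
    have "?M $$ (0, 0) = c" "?M $$ (m, 0) = d"
      using n m by (simp_all add: bidiag_circulant_entry)
    then show ?thesis
      using m(2) by (simp add: cofactor_def det0 detm)
  qed
  also have "\<dots> = c ^ n - (- d) ^ n"
    by (simp add: m(1) power_minus[of d])
  finally show ?thesis .
qed

text \<open>\<open>S\<close> delays the coefficient sequence by one step; the case
  \<open>k = 0\<close> is the wrap-around to index \<open>n - 1\<close>.\<close>

lemma right_circulant_mult_bidiag:
  fixes f :: "nat \<Rightarrow> 'a :: comm_ring_1"
  assumes n: "n \<ge> 2"
  shows "right_circulant n f * bidiag_circulant n c d =
    right_circulant n (\<lambda>k. c * f k + d * f (if k = 0 then n - 1 else k - 1))"
    (is "?F * ?M = ?G")
proof (rule eq_matI)
  fix i j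
  assume "i < dim_row ?G" "j < dim_col ?G"
  then have ij: "i < n" "j < n"
    by (simp_all add: right_circulant_def)
  \<comment> \<open>\<open>l\<close> is the cyclic predecessor of \<open>j\<close>: column
    \<open>j\<close> of \<open>?M\<close> vanishes outside rows \<open>j\<close> and
    \<open>l\<close>, which differ because \<open>n \<ge> 2\<close>.\<close>
  define l where "l = (if j = 0 then n - 1 else j - 1)"
  have l: "l < n" "l \<noteq> j"
    using ij n by (auto simp: l_def)
  have "(?F * ?M) $$ (i, j) = (\<Sum>k = 0..<n. ?F $$ (i, k) * ?M $$ (k, j))"
    using ij by (simp add: scalar_prod_def carrier_matD[OF right_circulant_carrier]
      carrier_matD[OF bidiag_circulant_carrier])
  also have "\<dots> = (\<Sum>k\<in>{j, l}. ?F $$ (i, k) * ?M $$ (k, j))"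
    using ij n l
    by (intro sum.mono_neutral_right) (auto simp: bidiag_circulant_entry l_def)
  also have "\<dots> = c * ?F $$ (i, j) + d * ?F $$ (i, l)"
    using ij n l by (auto simp: bidiag_circulant_entry l_def)
  also have "\<dots> = ?G $$ (i, j)"
    using ij n l(1)
    by (subst (1 2 3) right_circulant_entry) (auto simp: l_def intro!: arg_cong[of _ _ f])
  finally show "(?F * ?M) $$ (i, j) = ?G $$ (i, j)" .
qed (simp_all add: right_circulant_def bidiag_circulant_def)

text \<open>The factors \<open>1 - A ^ n\<close> and \<open>1 - B ^ n\<close> are the determinants
  of \<open>I - A S\<close> and \<open>I - B S\<close>. Keeping them on the left avoids division, so
  any commutative ring will do.\<close>

lemma det_right_circulant_recurrence:
  fixes f :: "nat \<Rightarrow> 'a :: comm_ring_1"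
  assumes n: "n \<ge> 2"
    and f0: "f 0 = 0"
    and rec: "\<And>k. f (Suc (Suc k)) = (A + B) * f (Suc k) - A * B * f k"
  shows "det (right_circulant n f) * (1 - A ^ n) * (1 - B ^ n) =
    (- f n) ^ n - (- (f 1 + A * B * f (n - 1))) ^ n"
proof -
  obtain m where m: "n = Suc (Suc m)"
    using n by (metis Suc_le_D numeral_2_eq_2 Suc_le_mono)
  have "right_circulant n f * bidiag_circulant n 1 (- A) * bidiag_circulant n 1 (- B) =
      bidiag_circulant n (- f n) (f 1 + A * B * f (n - 1))"
    unfolding right_circulant_mult_bidiag[OF n] bidiag_circulant_def[of n "- f n"]
  proof (rule right_circulant_cong, goal_cases)
    case (1 k)
    \<comment> \<open>The coefficient is
      \<open>f k - (A + B) * f (k - 1) + A * B * f (k - 2)\<close> with cyclic indices. It vanishes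
      for \<open>k \<ge> 2\<close>; at \<open>k = 0\<close>, where \<open>f 0 = 0\<close>, the
      wrapped terms give \<open>- f n\<close>, a value beyond the matrix entries.\<close>
    consider "k = 0" | "k = 1" | k' where "k = Suc (Suc k')"
      by (metis One_nat_def not0_implies_Suc)
    then show ?case
      by cases (auto simp: m f0 rec algebra_simps)
  qed
  then have "det (right_circulant n f * bidiag_circulant n 1 (- A) * bidiag_circulant n 1 (- B)) =
      (- f n) ^ n - (- (f 1 + A * B * f (n - 1))) ^ n"
    using n by (simp only: det_bidiag_circulant)
  then show ?thesis
    using n by (simp add: det_mult[of _ n] det_bidiag_circulant mult_carrier_mat[of _ n n])
qed

text \<open>Both \<alpha> and \<beta> are roots of \<open>t^2 = p t + q\<close>, so their powers
  satisfy the Lucas recurrence.\<close>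

lemma gen_lucas_binet:
  assumes "poly p x = \<alpha> + \<beta>" "poly q x = - (\<alpha> * \<beta>)"
  shows "poly (gen_lucas_poly p q n) x = \<alpha> ^ n + \<beta> ^ n"
  by (induction n rule: induct_nat_012) (simp_all add: assms algebra_simps)

theorem theorem2:
  fixes p q :: "real poly" and x a r \<alpha> \<beta> :: real and n :: nat
  assumes "poly p x \<noteq> 0" and "poly q x \<noteq> 0"
    and "(poly p x)\<^sup>2 + 4 * poly q x > 0"
    and "\<alpha> = (poly p x + sqrt ((poly p x)\<^sup>2 + 4 * poly q x)) / 2"
    and "\<beta> = (poly p x - sqrt ((poly p x)\<^sup>2 + 4 * poly q x)) / 2"
    and "a \<noteq> 0" and "r \<noteq> 0"
    and "r ^ n \<noteq> \<alpha> ^ n" and "r ^ n \<noteq> \<beta> ^ n"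
    and "n \<ge> 1"
  shows "det (right_circulant n (\<lambda>k. poly (gen_fib_poly p q k) x / (a * r ^ k))) =
    ((- 1) ^ n * r ^ n * poly (gen_fib_poly p q n) x ^ n
       - (poly q x * poly (gen_fib_poly p q (n - 1)) x - r ^ n) ^ n)
    / (a ^ n * r ^ (n * (n - 1))
       * (r ^ (2 * n) - r ^ n * poly (gen_lucas_poly p q n) x + (- poly q x) ^ n))"
\<comment> \<open>For \<open>n = 1\<close> the only entry is \<open>f 0 = 0\<close>, and the
  numerator is \<open>- r + r = 0\<close>.\<close>
proof (cases "n = 1")
  case True
  then show ?thesis
    by (simp add: right_circulant_def det_single)
next
  case False
  with \<open>n \<ge> 1\<close> have n: "n \<ge> 2"
    by simp
  define f where "f = (\<lambda>k. poly (gen_fib_poly p q k) x / (a * r ^ k))"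
  define Fn where "Fn = poly (gen_fib_poly p q n) x"
  define t where "t = poly q x * poly (gen_fib_poly p q (n - 1)) x - r ^ n"
  define D where "D = det (right_circulant n f)"
  have p: "poly p x = \<alpha> + \<beta>"
    using assms(4,5) by simp
  have q: "poly q x = - (\<alpha> * \<beta>)"
  proof -
    have "(sqrt ((poly p x)\<^sup>2 + 4 * poly q x))\<^sup>2 = (poly p x)\<^sup>2 + 4 * poly q x"
      using assms(3) by simp
    then show ?thesis
      unfolding assms(4,5) by (simp add: field_simps power2_eq_square)
  qed
  \<comment> \<open>Dividing by \<open>r ^ k\<close> scales the characteristic roots to
    \<open>\<alpha> / r\<close> and \<open>\<beta> / r\<close>.\<close>
  have rec: "f (Suc (Suc k)) = (\<alpha> / r + \<beta> / r) * f (Suc k) - \<alpha> / r * (\<beta> / r) * f k" for k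
    using \<open>a \<noteq> 0\<close> \<open>r \<noteq> 0\<close> by (simp add: f_def p q field_simps)
  have f1: "f 1 + \<alpha> / r * (\<beta> / r) * f (n - 1) = - t / (a * r ^ Suc n)"
  proof -
    have "r ^ n = r * r ^ (n - 1)"
      using n by (simp add: power_eq_if)
    then show ?thesis
      using \<open>a \<noteq> 0\<close> \<open>r \<noteq> 0\<close> by (simp add: f_def t_def q field_simps)
  qed
  \<comment> \<open>Expanding the product, the middle term is the Lucas value and the last is
    \<open>(\<alpha> * \<beta>) ^ n = (- q) ^ n\<close>.\<close>
  have den: "r ^ (2 * n) - r ^ n * poly (gen_lucas_poly p q n) x + (- poly q x) ^ n =
      (r ^ n - \<alpha> ^ n) * (r ^ n - \<beta> ^ n)"
    unfolding power_even_eq power2_eq_square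
    by (simp add: gen_lucas_binet[OF p q] q power_mult_distrib algebra_simps)
  have "D * (1 - (\<alpha> / r) ^ n) * (1 - (\<beta> / r) ^ n) =
      (- f n) ^ n - (- (f 1 + \<alpha> / r * (\<beta> / r) * f (n - 1))) ^ n"
    unfolding D_def
    by (rule det_right_circulant_recurrence[where f = f, OF n _ rec]) (simp add: f_def)
  also have "\<dots> = (- Fn / (a * r ^ n)) ^ n - (t / (a * r ^ Suc n)) ^ n"
    unfolding f1 by (simp add: f_def Fn_def)
  also have "\<dots> = ((- 1) ^ n * r ^ n * Fn ^ n - t ^ n) / (a ^ n * (r ^ (n * n) * r ^ n))"
    using \<open>a \<noteq> 0\<close> \<open>r \<noteq> 0\<close>
    by (simp add: power_divide power_mult_distrib power_minus[of "Fn / (a * r ^ n)"] field_simps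
      flip: power_mult)
  \<comment> \<open>The factor \<open>r ^ n * r ^ n\<close> split off here cancels against the
    denominators of \<open>1 - (\<alpha> / r) ^ n\<close> and
    \<open>1 - (\<beta> / r) ^ n\<close>.\<close>
  also have "r ^ (n * n) * r ^ n = r ^ (n * (n - 1)) * (r ^ n * r ^ n)"
    by (simp add: algebra_simps flip: power_add)
  finally have main: "D * (1 - (\<alpha> / r) ^ n) * (1 - (\<beta> / r) ^ n) =
      ((- 1) ^ n * r ^ n * Fn ^ n - t ^ n) / (a ^ n * (r ^ (n * (n - 1)) * (r ^ n * r ^ n)))"
    by (simp add: mult.assoc)
  have "1 - (\<alpha> / r) ^ n = (r ^ n - \<alpha> ^ n) / r ^ n" "1 - (\<beta> / r) ^ n = (r ^ n - \<beta> ^ n) / r ^ n"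
    using \<open>r \<noteq> 0\<close> by (simp_all add: power_divide field_simps)
  note main[unfolded this]
  then have "D * ((r ^ n - \<alpha> ^ n) * (r ^ n - \<beta> ^ n)) / (r ^ n * r ^ n) =
      ((- 1) ^ n * r ^ n * Fn ^ n - t ^ n) / (a ^ n * r ^ (n * (n - 1))) / (r ^ n * r ^ n)"
    by (simp only: times_divide_eq_left times_divide_eq_right divide_divide_eq_left mult.assoc)
  then have "D * ((r ^ n - \<alpha> ^ n) * (r ^ n - \<beta> ^ n)) =
      ((- 1) ^ n * r ^ n * Fn ^ n - t ^ n) / (a ^ n * r ^ (n * (n - 1)))"
    using \<open>r \<noteq> 0\<close> by (simp only: divide_cancel_right mult_eq_0_iff power_eq_0_iff) simp
  moreover have "(r ^ n - \<alpha> ^ n) * (r ^ n - \<beta> ^ n) \<noteq> 0"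
    using assms(8,9) by simp
  ultimately show ?thesis
    unfolding den Fn_def[symmetric] t_def[symmetric] D_def[symmetric] f_def[symmetric]
    by (metis nonzero_eq_divide_eq divide_divide_eq_left)
qed

end
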